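(* Let $A_1, A_2, \ldots$ be a sequence of events on a common probability space with probability measure $P$, satisfying $P\{A_n\}\to 0$ as $n\to\infty$. Suppose also that for some integer $m\geq 0$ $$\sum_{n=1}^\infty P\{\overline{A}_n\cap\overline{A}_{n+1}\cap\cdots\cap\overline{A}_{n+m-1}\cap A_{n+m}\}<\infty .$$ Then $P\{A_n\ \text{i.o.}\}=0$.
   Context: $\overline{A}_i$ denotes the complement of the event $A_i$. The event $\{A_n\ \text{i.o.}\}$ ("infinitely often") is $\bigcap_{n=1}^\infty\bigcup_{k=n}^\infty A_k$. When $m=0$ the intersection of complements is empty (no complements appear), so the summand is $P\{A_n\}$; when $m=1$ the summand is $P\{\overline{A}_n\cap A_{n+1}\}$. *)

theory Defs
  imports "HOL-Probability.Probability"
begin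

text \<open>Infinitely often, for a sequence indexed from 1; the value at index 0 is ignored.\<close>
definition infinitely_often :: "(nat \<Rightarrow> 'a set) \<Rightarrow> 'a set" where
  "infinitely_often A = (\<Inter>n\<in>{1..}. \<Union>k\<in>{n..}. A k)"

end

theory Submission
  imports Defs
begin

text \<open>For every \<open>N\<close>, the first index \<open>k \<ge> N\<close> at which a point of \<open>\<Union>k\<ge>N. A k\<close> enters the sequence
  is either below \<open>N + m\<close>, or it is preceded by \<open>m\<close> indices \<open>\<ge> N\<close> at which the point is outside.
  By the union bound, the first alternative has probability at most a sum of \<open>m\<close> terms tending
  to 0, the second at most the tail of a convergent series.\<close>

lemma UN_atLeast_subset_first_entry:
  fixes A :: "nat \<Rightarrow> 'a set"
  assumes "\<And>k. k \<ge> N \<Longrightarrow> A k \<subseteq> S"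
  shows "(\<Union>k\<in>{N..}. A k) \<subseteq>
    (\<Union>j<m. A (j + N)) \<union> (\<Union>i. (\<Inter>k\<in>{i + N..<i + N + m}. S - A k) \<inter> A (i + N + m))"
proof
  fix x assume "x \<in> (\<Union>k\<in>{N..}. A k)"
  then have ex: "\<exists>k. k \<ge> N \<and> x \<in> A k" by auto
  define k where "k = (LEAST k. k \<ge> N \<and> x \<in> A k)"
  have k: "k \<ge> N" "x \<in> A k"
    using LeastI_ex[OF ex] by (auto simp: k_def)
  have before: "x \<notin> A l" if "N \<le> l" "l < k" for l
    using not_less_Least[of l "\<lambda>k. k \<ge> N \<and> x \<in> A k"] that by (auto simp: k_def)
  show "x \<in> (\<Union>j<m. A (j + N)) \<union>
    (\<Union>i. (\<Inter>k\<in>{i + N..<i + N + m}. S - A k) \<inter> A (i + N + m))"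
  proof (cases "k < N + m")
    case True
    then have "k - N < m" "x \<in> A ((k - N) + N)" using k by auto
    then show ?thesis by blast
  next
    case False
    \<comment> \<open>The window of \<open>m\<close> indices ending just before \<open>k\<close>
      starts at \<open>i + N\<close>, which is at least \<open>N\<close> because
      \<open>k \<ge> N + m\<close>; minimality of \<open>k\<close> keeps \<open>x\<close> out of
      every \<open>A l\<close> in it.\<close>
    define i where "i = k - N - m"
    have i: "i + N + m = k" using False by (simp add: i_def)
    have "x \<in> S" using assms k by blast
    then have "x \<in> (\<Inter>k\<in>{i + N..<i + N + m}. S - A k) \<inter> A (i + N + m)"
      using before k by (auto simp: i)
    then show ?thesis by blast
  qed
qed

theorem lemma2p1:
  fixes M :: "'a measure" and A :: "nat \<Rightarrow> 'a set" and m :: nat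
  assumes "prob_space M"
    and "\<And>n. n \<ge> 1 \<Longrightarrow> A n \<in> sets M"
    and "(\<lambda>n. measure M (A n)) \<longlonglongrightarrow> 0"
    and "(\<lambda>n. measure M ((\<Inter>k\<in>{n..<n + m}. space M - A k) \<inter> A (n + m))) summable_on {1..}"
  shows "measure M (infinitely_often A) = 0"
proof -
  interpret prob_space M by fact
  define B where "B = (\<lambda>n. (\<Inter>k\<in>{n..<n + m}. space M - A k) \<inter> A (n + m))"
  have B_sets: "B n \<in> sets M" if "n \<ge> 1" for n
  \<comment> \<open>For \<open>m = 0\<close> the intersection over the empty range is
    \<open>UNIV\<close>, which need not be measurable; there \<open>B n\<close> is just
    \<open>A n\<close>.\<close>
  proof (cases "m = 0")
    case True
    then show ?thesis using assms(2) that by (simp add: B_def)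
  next
    case False
    then have "(\<Inter>k\<in>{n..<n + m}. space M - A k) \<in> sets M"
      using assms(2) that by (intro sets.finite_INT) auto
    then show ?thesis
      using assms(2) that by (auto simp: B_def)
  qed
  \<comment> \<open>Index 0 lies outside the hypothesis on the series. One extra term does not
    affect summability, and over all naturals \<open>summable_on\<close> for nonnegative terms is
    the same as \<open>summable\<close>, which gives access to tails of the series.\<close>
  have "(\<lambda>n. prob (B n)) summable_on insert 0 {1..}"
    using assms(4) by (simp add: B_def summable_on_insert_iff)
  also have "insert 0 {1..} = (UNIV :: nat set)"
    by (auto simp: not_less_eq_eq)
  finally have sm: "summable (\<lambda>n. prob (B n))"
    by (simp add: summable_on_UNIV_nonneg_real_iff)
  have bound: "prob (infinitely_often A) \<le>
      (\<Sum>j<m. prob (A (j + N))) + (\<Sum>i. prob (B (i + N)))" if N: "N \<ge> 1" for N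
  proof -
    have smN: "summable (\<lambda>i. prob (B (i + N)))"
      using sm by (rule summable_ignore_initial_segment)
    have A_sets: "range (\<lambda>i. B (i + N)) \<subseteq> sets M" "(\<lambda>j. A (j + N)) ` {..<m} \<subseteq> sets M"
      using B_sets assms(2) N by auto
    have "infinitely_often A \<subseteq> (\<Union>k\<in>{N..}. A k)"
      using N by (auto simp: infinitely_often_def)
    also have "\<dots> \<subseteq> (\<Union>j<m. A (j + N)) \<union> (\<Union>i. B (i + N))"
      unfolding B_def using assms(2) N
      by (intro UN_atLeast_subset_first_entry sets.sets_into_space) auto
    finally have "prob (infinitely_often A) \<le> prob ((\<Union>j<m. A (j + N)) \<union> (\<Union>i. B (i + N)))"
      using A_sets by (intro finite_measure_mono sets.Un sets.countable_UN sets.finite_UN) auto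
    also have "\<dots> \<le> prob (\<Union>j<m. A (j + N)) + prob (\<Union>i. B (i + N))"
      using A_sets by (intro measure_Un_le sets.countable_UN sets.finite_UN) auto
    also have "\<dots> \<le> (\<Sum>j<m. prob (A (j + N))) + (\<Sum>i. prob (B (i + N)))"
      using A_sets smN
      by (intro add_mono finite_measure_subadditive_finite finite_measure_subadditive_countably) auto
    finally show ?thesis .
  qed
  have "(\<lambda>N. \<Sum>j<m. prob (A (j + N))) \<longlonglongrightarrow> (\<Sum>j<m. 0)"
    using LIMSEQ_ignore_initial_segment[OF assms(3)]
    by (intro tendsto_sum) (simp add: add.commute)
  then have "(\<lambda>N. (\<Sum>j<m. prob (A (j + N))) + (\<Sum>i. prob (B (i + N)))) \<longlonglongrightarrow> 0 + 0"
    by (intro tendsto_add suminf_exist_split2 sm) simp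
  \<comment> \<open>The left side does not depend on \<open>N\<close>, so the bound, valid from
    \<open>N = 1\<close> on, passes to the limit.\<close>
  then have "prob (infinitely_often A) \<le> 0 + 0"
    by (rule LIMSEQ_le_const) (use bound in blast)
  then show ?thesis by (simp add: measure_le_0_iff)
qed

end
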